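(* Let $b$ be a weighted graph over $(X,m)$. For every intrinsic pseudo metric $\sigma$ (with respect to $b$ and $m$) there exists a maximal intrinsic pseudo metric $\varrho$ with $\sigma\le\varrho$, i.e. $\sigma(x,y)\le\varrho(x,y)$ for all $x,y\in X$.
   Context: $X$ is a nonempty countable (finite or countably infinite) set and $m\colon X\to(0,\infty)$. A weighted graph over $(X,m)$ is a symmetric function $b\colon X\times X\to[0,\infty)$ with $b(x,x)=0$ and $\sum_{y\in X}b(x,y)<\infty$ for all $x\in X$. A pseudo metric on $X$ is a symmetric function $\sigma\colon X\times X\to[0,\infty)$ with $\sigma(x,x)=0$ satisfying the triangle inequality. It is intrinsic with respect to $b$ and $m$ if $\frac1{m(x)}\sum_{y\in X}b(x,y)\sigma(x,y)^2\le1$ for every $x\in X$. An intrinsic pseudo metric $\sigma$ is maximal if for any other intrinsic pseudo metric $\varrho$ the inequality $\sigma(x,y)\le\varrho(x,y)$ for all $x,y\in X$ implies $\varrho=\sigma$.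
   Formalization: The weighted graph b is additionally assumed connected; for every disconnected b (e.g. two points with b = 0) distances between components can always be increased, so no maximal intrinsic pseudo metric exists. *)

theory Defs
  imports "HOL-Analysis.Infinite_Sum" "HOL-Library.Countable_Set"
begin

definition measure_weight :: "'a set \<Rightarrow> ('a \<Rightarrow> real) \<Rightarrow> bool" where
  "measure_weight X m \<longleftrightarrow> X \<noteq> {} \<and> countable X \<and> (\<forall>x\<in>X. 0 < m x)"

definition weighted_graph :: "'a set \<Rightarrow> ('a \<Rightarrow> 'a \<Rightarrow> real) \<Rightarrow> bool" where
  "weighted_graph X b \<longleftrightarrow>
     (\<forall>x\<in>X. \<forall>y\<in>X. 0 \<le> b x y \<and> b x y = b y x) \<and>
     (\<forall>x\<in>X. b x x = 0) \<and>
     (\<forall>x\<in>X. (\<lambda>y. b x y) summable_on X)"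

text \<open>
  Pseudo metrics are finite-valued. If \<open>X\<close> has two connected components, the distance
  between points of different components can always be increased without affecting the
  intrinsic bound, so no intrinsic pseudo metric is maximal. Existence therefore needs
  connectedness: any two points are joined by a path of edges of positive weight.
\<close>

definition connected_graph :: "'a set \<Rightarrow> ('a \<Rightarrow> 'a \<Rightarrow> real) \<Rightarrow> bool" where
  "connected_graph X b \<longleftrightarrow>
     (\<forall>x\<in>X. \<forall>y\<in>X. (x, y) \<in> {(u, v). u \<in> X \<and> v \<in> X \<and> 0 < b u v}\<^sup>*)"

definition pseudo_metric :: "'a set \<Rightarrow> ('a \<Rightarrow> 'a \<Rightarrow> real) \<Rightarrow> bool" where
  "pseudo_metric X \<sigma> \<longleftrightarrow>
     (\<forall>x\<in>X. \<forall>y\<in>X. 0 \<le> \<sigma> x y \<and> \<sigma> x y = \<sigma> y x) \<and>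
     (\<forall>x\<in>X. \<sigma> x x = 0) \<and>
     (\<forall>x\<in>X. \<forall>y\<in>X. \<forall>z\<in>X. \<sigma> x z \<le> \<sigma> x y + \<sigma> y z)"

text \<open>
  In the source the series is a sum of nonnegative terms with value in \<open>[0,\<infinity>]\<close>, so the bound
  includes its convergence. The real-valued \<^const>\<open>infsum\<close> is 0 for a divergent series, so
  convergence has to be required separately.
\<close>

definition intrinsic_pseudo_metric ::
  "'a set \<Rightarrow> ('a \<Rightarrow> real) \<Rightarrow> ('a \<Rightarrow> 'a \<Rightarrow> real) \<Rightarrow> ('a \<Rightarrow> 'a \<Rightarrow> real) \<Rightarrow> bool" where
  "intrinsic_pseudo_metric X m b \<sigma> \<longleftrightarrow>
     pseudo_metric X \<sigma> \<and>
     (\<forall>x\<in>X. (\<lambda>y. b x y * (\<sigma> x y)\<^sup>2) summable_on X \<and>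
            1 / m x * (\<Sum>\<^sub>\<infinity>y\<in>X. b x y * (\<sigma> x y)\<^sup>2) \<le> 1)"

text \<open>
  Functions on \<open>X \<times> X\<close> are represented by total functions with irrelevant values outside
  \<open>X\<close>, so equality of pseudo metrics is equality on \<open>X \<times> X\<close>.
\<close>

definition maximal_intrinsic_pseudo_metric ::
  "'a set \<Rightarrow> ('a \<Rightarrow> real) \<Rightarrow> ('a \<Rightarrow> 'a \<Rightarrow> real) \<Rightarrow> ('a \<Rightarrow> 'a \<Rightarrow> real) \<Rightarrow> bool" where
  "maximal_intrinsic_pseudo_metric X m b \<sigma> \<longleftrightarrow>
     intrinsic_pseudo_metric X m b \<sigma> \<and>
     (\<forall>\<rho>. intrinsic_pseudo_metric X m b \<rho> \<longrightarrow>
        (\<forall>x\<in>X. \<forall>y\<in>X. \<sigma> x y \<le> \<rho> x y) \<longrightarrow>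
        (\<forall>x\<in>X. \<forall>y\<in>X. \<rho> x y = \<sigma> x y))"

end

theory Submission
  imports Defs
begin

text \<open>
  The proof applies Zorn's lemma to the intrinsic pseudo metrics above \<open>\<sigma>\<close>, ordered pointwise; the
  upper bound of a chain is its pointwise supremum. A maximal element of this set is maximal among
  all intrinsic pseudo metrics, since whatever dominates it also lies above \<open>\<sigma>\<close>. Two things have to
  be checked about the supremum.

  \<^item> The supremum is finite. A single summand of the intrinsic bound of \<open>\<rho>\<close> at \<open>x\<close> gives
    \<open>b x y * (\<rho> x y)\<^sup>2 \<le> m x\<close>, so an intrinsic pseudo metric is bounded on each edge by a constant
    that depends only on the edge. By the triangle inequality these constants add up along paths,
    and every pair of points is joined by a path (\<open>intrinsic_bounded_along_path\<close>).

  \<^item> The supremum is intrinsic (\<open>intrinsic_directed_Sup\<close>). All summands are nonnegative, so the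
    intrinsic bound only concerns sums over finite sets of neighbours (\<open>intrinsic_iff_finite_sums\<close>).
    In a directed family, one single member is close to the supremum on all of these finitely many
    neighbours, and for this member the bound is known.
\<close>

lemma intrinsic_iff_finite_sums:
  assumes "measure_weight X m" and "weighted_graph X b"
  shows "intrinsic_pseudo_metric X m b \<sigma> \<longleftrightarrow> pseudo_metric X \<sigma> \<and>
    (\<forall>x\<in>X. \<forall>F. finite F \<longrightarrow> F \<subseteq> X \<longrightarrow> (\<Sum>y\<in>F. b x y * (\<sigma> x y)\<^sup>2) \<le> m x)"
proof -
  have "((\<lambda>y. b x y * (\<sigma> x y)\<^sup>2) summable_on X \<and> 1 / m x * (\<Sum>\<^sub>\<infinity>y\<in>X. b x y * (\<sigma> x y)\<^sup>2) \<le> 1)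
      \<longleftrightarrow> (\<forall>F. finite F \<longrightarrow> F \<subseteq> X \<longrightarrow> (\<Sum>y\<in>F. b x y * (\<sigma> x y)\<^sup>2) \<le> m x)" (is "?L \<longleftrightarrow> ?R")
    if x: "x \<in> X" for x
  proof
    have m: "0 < m x" using assms(1) x by (simp add: measure_weight_def)
    have nonneg: "0 \<le> b x y * (\<sigma> x y)\<^sup>2" if "y \<in> X" for y
      using assms(2) x that by (simp add: weighted_graph_def)
    show ?R if ?L
    proof (intro allI impI)
      fix F assume F: "finite F" "F \<subseteq> X"
      have "(\<Sum>y\<in>F. b x y * (\<sigma> x y)\<^sup>2) \<le> (\<Sum>\<^sub>\<infinity>y\<in>X. b x y * (\<sigma> x y)\<^sup>2)"
        using that F nonneg by (intro finite_sum_le_infsum) auto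
      also have "\<dots> \<le> m x"
        using that m by (simp add: field_simps)
      finally show "(\<Sum>y\<in>F. b x y * (\<sigma> x y)\<^sup>2) \<le> m x" .
    qed
    show ?L if R: ?R
    proof
      show summable: "(\<lambda>y. b x y * (\<sigma> x y)\<^sup>2) summable_on X"
        using nonneg R by (intro nonneg_bdd_above_summable_on bdd_aboveI2[where M = "m x"]) auto
      have "(\<Sum>\<^sub>\<infinity>y\<in>X. b x y * (\<sigma> x y)\<^sup>2) \<le> m x"
        using summable R by (intro infsum_le_finite_sums) auto
      then show "1 / m x * (\<Sum>\<^sub>\<infinity>y\<in>X. b x y * (\<sigma> x y)\<^sup>2) \<le> 1"
        using m by (simp add: field_simps)
    qed
  qed
  then show ?thesis
    by (simp add: intrinsic_pseudo_metric_def)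
qed

text \<open>
  An edge of weight \<open>b y z\<close> contributes at most \<open>sqrt (m y / b y z)\<close>. The point is the order of the
  quantifiers: the bound is the same for all intrinsic pseudo metrics.
\<close>

lemma intrinsic_bounded_along_path:
  assumes "measure_weight X m" and "weighted_graph X b"
    and "x \<in> X" and "(x, y) \<in> {(u, v). u \<in> X \<and> v \<in> X \<and> 0 < b u v}\<^sup>*"
  shows "\<exists>B. \<forall>\<sigma>. intrinsic_pseudo_metric X m b \<sigma> \<longrightarrow> \<sigma> x y \<le> B"
  using assms(4)
proof (induction rule: rtrancl_induct)
  case base
  show ?case
    using assms(3) by (intro exI[of _ 0]) (simp add: intrinsic_pseudo_metric_def pseudo_metric_def)
next
  case (step y z)
  then obtain B where B: "\<And>\<sigma>. intrinsic_pseudo_metric X m b \<sigma> \<Longrightarrow> \<sigma> x y \<le> B" by blast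
  have yz: "y \<in> X" "z \<in> X" "0 < b y z" using step.hyps by auto
  have "\<sigma> x z \<le> B + sqrt (m y / b y z)" if \<sigma>: "intrinsic_pseudo_metric X m b \<sigma>" for \<sigma>
  proof -
    have "(\<Sum>v\<in>{z}. b y v * (\<sigma> y v)\<^sup>2) \<le> m y"
      using \<sigma> yz unfolding intrinsic_iff_finite_sums[OF assms(1,2)] by blast
    then have "(\<sigma> y z)\<^sup>2 \<le> m y / b y z"
      using yz by (simp add: field_simps)
    then have "\<sigma> y z \<le> sqrt (m y / b y z)"
      by (rule real_le_rsqrt)
    moreover have "\<sigma> x z \<le> \<sigma> x y + \<sigma> y z"
      using \<sigma> yz assms(3) by (simp add: intrinsic_pseudo_metric_def pseudo_metric_def)
    ultimately show ?thesis using B[OF \<sigma>] by linarith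
  qed
  then show ?case by blast
qed

lemma pseudo_metric_Sup:
  assumes "C \<noteq> {}" and pm: "\<And>\<rho>. \<rho> \<in> C \<Longrightarrow> pseudo_metric X \<rho>"
    and bdd: "\<And>x y. x \<in> X \<Longrightarrow> y \<in> X \<Longrightarrow> bdd_above ((\<lambda>\<rho>. \<rho> x y) ` C)"
  shows "pseudo_metric X (\<lambda>x y. SUP \<rho>\<in>C. \<rho> x y)"
proof -
  have upper: "\<rho> x y \<le> (SUP \<rho>\<in>C. \<rho> x y)" if "\<rho> \<in> C" "x \<in> X" "y \<in> X" for \<rho> x y
    using that by (intro cSUP_upper bdd)
  obtain \<rho>0 where \<rho>0: "\<rho>0 \<in> C" using assms(1) by blast
  have "0 \<le> (SUP \<rho>\<in>C. \<rho> x y)" if "x \<in> X" "y \<in> X" for x y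
  proof -
    have "0 \<le> \<rho>0 x y" using pm[OF \<rho>0] that unfolding pseudo_metric_def by blast
    then show ?thesis using upper[OF \<rho>0 that] by linarith
  qed
  moreover have "(SUP \<rho>\<in>C. \<rho> x y) = (SUP \<rho>\<in>C. \<rho> y x)" if "x \<in> X" "y \<in> X" for x y
    using pm that unfolding pseudo_metric_def by (intro SUP_cong refl) blast
  moreover have "(SUP \<rho>\<in>C. \<rho> x x) = 0" if "x \<in> X" for x
  proof -
    have "(SUP \<rho>\<in>C. \<rho> x x) = (SUP \<rho>\<in>C. 0)"
      using pm that unfolding pseudo_metric_def by (intro SUP_cong refl) blast
    then show ?thesis using assms(1) by simp
  qed
  moreover have "(SUP \<rho>\<in>C. \<rho> x z) \<le> (SUP \<rho>\<in>C. \<rho> x y) + (SUP \<rho>\<in>C. \<rho> y z)"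
    if "x \<in> X" "y \<in> X" "z \<in> X" for x y z
  proof (rule cSUP_least[OF assms(1)])
    fix \<rho> assume \<rho>: "\<rho> \<in> C"
    have "\<rho> x z \<le> \<rho> x y + \<rho> y z"
      using pm[OF \<rho>] that by (simp add: pseudo_metric_def)
    then show "\<rho> x z \<le> (SUP \<rho>\<in>C. \<rho> x y) + (SUP \<rho>\<in>C. \<rho> y z)"
      using upper[OF \<rho>, of x y] upper[OF \<rho>, of y z] that by linarith
  qed
  ultimately show ?thesis
    unfolding pseudo_metric_def by blast
qed

text \<open>
  Directedness is what allows the quantifiers to be exchanged: each point of \<open>F\<close> has its own function
  almost attaining the supremum there, and one member of the family dominates these finitely many.
\<close>

lemma directed_Sup_approx_on_finite:
  fixes C :: "('i \<Rightarrow> real) set"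
  assumes "C \<noteq> {}" and "finite F" and "0 < e"
    and directed: "\<And>f g. f \<in> C \<Longrightarrow> g \<in> C \<Longrightarrow> \<exists>h\<in>C. \<forall>i\<in>F. f i \<le> h i \<and> g i \<le> h i"
    and bdd: "\<And>i. i \<in> F \<Longrightarrow> bdd_above ((\<lambda>f. f i) ` C)"
  shows "\<exists>f\<in>C. \<forall>i\<in>F. (SUP f\<in>C. f i) - e < f i"
proof -
  have "\<exists>f\<in>C. \<forall>i\<in>G. (SUP f\<in>C. f i) - e < f i" if "G \<subseteq> F" for G
    using finite_subset[OF that assms(2)] that
  proof (induction rule: finite_induct)
    case empty
    then show ?case using assms(1) by blast
  next
    case (insert j G)
    then obtain f where f: "f \<in> C" "\<forall>i\<in>G. (SUP f\<in>C. f i) - e < f i" by blast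
    have "(SUP f\<in>C. f j) - e < (SUP f\<in>C. f j)" using assms(3) by simp
    then obtain g where g: "g \<in> C" "(SUP f\<in>C. f j) - e < g j"
      using iffD1[OF less_cSUP_iff[OF assms(1) bdd[of j]]] insert.prems by blast
    obtain h where "h \<in> C" "\<forall>i\<in>F. f i \<le> h i \<and> g i \<le> h i"
      using directed[OF f(1) g(1)] by blast
    then show ?case
      using f(2) g(2) insert.prems by (intro bexI[of _ h]) (auto intro: less_le_trans)
  qed
  then show ?thesis by blast
qed

lemma intrinsic_directed_Sup:
  assumes mw: "measure_weight X m" and wg: "weighted_graph X b"
    and "C \<noteq> {}" and intr: "\<And>\<rho>. \<rho> \<in> C \<Longrightarrow> intrinsic_pseudo_metric X m b \<rho>"
    and directed: "\<And>\<rho> \<tau>. \<rho> \<in> C \<Longrightarrow> \<tau> \<in> C \<Longrightarrow>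
      \<exists>\<kappa>\<in>C. \<forall>x\<in>X. \<forall>y\<in>X. \<rho> x y \<le> \<kappa> x y \<and> \<tau> x y \<le> \<kappa> x y"
    and bdd: "\<And>x y. x \<in> X \<Longrightarrow> y \<in> X \<Longrightarrow> bdd_above ((\<lambda>\<rho>. \<rho> x y) ` C)"
  shows "intrinsic_pseudo_metric X m b (\<lambda>x y. SUP \<rho>\<in>C. \<rho> x y)"
  unfolding intrinsic_iff_finite_sums[OF mw wg]
proof (intro conjI ballI allI impI)
  show pm: "pseudo_metric X (\<lambda>x y. SUP \<rho>\<in>C. \<rho> x y)"
    using assms(3) intr bdd by (intro pseudo_metric_Sup) (auto simp: intrinsic_pseudo_metric_def)
  fix x F assume x: "x \<in> X" and F: "finite F" "F \<subseteq> X"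
  define S where "S y = (SUP \<rho>\<in>C. \<rho> x y)" for y
  have S_nonneg: "0 \<le> S y" if "y \<in> F" for y
    using pm x F that unfolding pseudo_metric_def S_def by blast
  \<comment> \<open>Truncation at 0 keeps the squares monotone where \<open>S y < e\<close>.\<close>
  have approx: "(\<Sum>y\<in>F. b x y * (max 0 (S y - e))\<^sup>2) \<le> m x" if "0 < e" for e
  proof -
    have "\<exists>f\<in>(\<lambda>\<rho>. \<rho> x) ` C. \<forall>y\<in>F. (SUP f\<in>(\<lambda>\<rho>. \<rho> x) ` C. f y) - e < f y"
    proof (rule directed_Sup_approx_on_finite)
      show "\<exists>h\<in>(\<lambda>\<rho>. \<rho> x) ` C. \<forall>y\<in>F. f y \<le> h y \<and> g y \<le> h y"
        if fg: "f \<in> (\<lambda>\<rho>. \<rho> x) ` C" "g \<in> (\<lambda>\<rho>. \<rho> x) ` C" for f g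
      proof -
        obtain \<rho> \<tau> where "\<rho> \<in> C" "\<tau> \<in> C" "f = \<rho> x" "g = \<tau> x" using fg by blast
        then show ?thesis using directed[of \<rho> \<tau>] x F by blast
      qed
    qed (use assms(3) F x bdd that in \<open>auto simp: image_image\<close>)
    then obtain \<rho> where \<rho>: "\<rho> \<in> C" "\<forall>y\<in>F. S y - e < \<rho> x y"
      by (auto simp: image_image S_def)
    have "(\<Sum>y\<in>F. b x y * (max 0 (S y - e))\<^sup>2) \<le> (\<Sum>y\<in>F. b x y * (\<rho> x y)\<^sup>2)"
    proof (intro sum_mono mult_left_mono power_mono)
      fix y assume y: "y \<in> F"
      show "max 0 (S y - e) \<le> \<rho> x y"
        using \<rho> y F x intr[OF \<rho>(1)]
        by (auto simp: intrinsic_pseudo_metric_def pseudo_metric_def intro: less_imp_le)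
      show "0 \<le> b x y"
        using wg x y F by (auto simp: weighted_graph_def)
    qed simp
    also have "\<dots> \<le> m x"
      using intr[OF \<rho>(1)] x F unfolding intrinsic_iff_finite_sums[OF mw wg] by blast
    finally show ?thesis .
  qed
  have "((\<lambda>e. \<Sum>y\<in>F. b x y * (max 0 (S y - e))\<^sup>2) \<longlongrightarrow>
      (\<Sum>y\<in>F. b x y * (max 0 (S y - 0))\<^sup>2)) (at_right 0)"
    by (intro tendsto_intros)
  then have "(\<Sum>y\<in>F. b x y * (max 0 (S y - 0))\<^sup>2) \<le> m x"
    by (rule tendsto_upperbound) (auto simp: eventually_at_filter approx)
  then have "(\<Sum>y\<in>F. b x y * (S y)\<^sup>2) \<le> m x"
    using S_nonneg by (simp add: max_def cong: sum.cong)
  then show "(\<Sum>y\<in>F. b x y * (SUP \<rho>\<in>C. \<rho> x y)\<^sup>2) \<le> m x"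
    by (simp add: S_def)
qed

lemma intrinsic_cong:
  assumes "\<And>x y. x \<in> X \<Longrightarrow> y \<in> X \<Longrightarrow> \<sigma> x y = \<rho> x y"
  shows "intrinsic_pseudo_metric X m b \<sigma> \<longleftrightarrow> intrinsic_pseudo_metric X m b \<rho>"
proof -
  have "pseudo_metric X \<sigma> \<longleftrightarrow> pseudo_metric X \<rho>"
    unfolding pseudo_metric_def by (intro arg_cong2[where f = "(\<and>)"] ball_cong refl) (simp_all only: assms)
  moreover have "(\<lambda>y. b x y * (\<sigma> x y)\<^sup>2) summable_on X \<longleftrightarrow> (\<lambda>y. b x y * (\<rho> x y)\<^sup>2) summable_on X"
    if "x \<in> X" for x
    using assms that by (intro summable_on_cong) simp
  moreover have "(\<Sum>\<^sub>\<infinity>y\<in>X. b x y * (\<sigma> x y)\<^sup>2) = (\<Sum>\<^sub>\<infinity>y\<in>X. b x y * (\<rho> x y)\<^sup>2)" if "x \<in> X" for x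
    using assms that by (intro infsum_cong) simp
  ultimately show ?thesis
    by (simp add: intrinsic_pseudo_metric_def)
qed

theorem proposition3p7:
  fixes X :: "'a set" and m :: "'a \<Rightarrow> real" and b \<sigma> :: "'a \<Rightarrow> 'a \<Rightarrow> real"
  assumes "measure_weight X m"
    and "weighted_graph X b"
    and "connected_graph X b"
    and "intrinsic_pseudo_metric X m b \<sigma>"
  shows "\<exists>\<rho>. maximal_intrinsic_pseudo_metric X m b \<rho> \<and> (\<forall>x\<in>X. \<forall>y\<in>X. \<sigma> x y \<le> \<rho> x y)"
proof -
  \<comment> \<open>Functions that agree on \<open>X \<times> X\<close> have to be identified for the order to be antisymmetric;
    each class is represented by its member that vanishes outside \<open>X \<times> X\<close>.\<close>
  define restr :: "('a \<Rightarrow> 'a \<Rightarrow> real) \<Rightarrow> 'a \<Rightarrow> 'a \<Rightarrow> real"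
    where "restr \<rho> = (\<lambda>x y. if x \<in> X \<and> y \<in> X then \<rho> x y else 0)" for \<rho>
  have restr_idem: "restr (restr \<rho>) = restr \<rho>" for \<rho>
    by (auto simp: restr_def fun_eq_iff)
  have restr_intrinsic: "intrinsic_pseudo_metric X m b (restr \<rho>)"
    if "intrinsic_pseudo_metric X m b \<rho>" for \<rho>
    using that by (subst intrinsic_cong[of X _ \<rho>]) (auto simp: restr_def)
  define A where "A = {\<rho>. intrinsic_pseudo_metric X m b \<rho> \<and> restr \<rho> = \<rho> \<and> restr \<sigma> \<le> \<rho>}"
  have "\<exists>\<rho>\<in>A. \<forall>\<tau>\<in>A. \<rho> \<le> \<tau> \<longrightarrow> \<tau> = \<rho>"
  proof (rule predicate_Zorn)
    show "partial_order_on A (relation_of (\<le>) A)"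
      by (rule partial_order_on_relation_ofI) auto
    fix C assume C: "C \<in> Chains (relation_of (\<le>) A)"
    then have C_sub: "C \<subseteq> A" and chain: "\<And>\<rho> \<tau>. \<rho> \<in> C \<Longrightarrow> \<tau> \<in> C \<Longrightarrow> \<rho> \<le> \<tau> \<or> \<tau> \<le> \<rho>"
      by (auto simp: Chains_def relation_of_def)
    show "\<exists>\<tau>\<in>A. \<forall>\<rho>\<in>C. \<rho> \<le> \<tau>"
    proof (cases "C = {}")
      case True
      have "restr \<sigma> \<in> A"
        using restr_intrinsic[OF assms(4)] by (simp add: A_def restr_idem)
      with True show ?thesis by blast
    next
      case False
      have intr: "intrinsic_pseudo_metric X m b \<rho>" if "\<rho> \<in> C" for \<rho>
        using that C_sub by (auto simp: A_def)
      have bdd: "bdd_above ((\<lambda>\<rho>. \<rho> x y) ` C)" if xy: "x \<in> X" "y \<in> X" for x y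
      proof -
        obtain B where "\<And>\<rho>. intrinsic_pseudo_metric X m b \<rho> \<Longrightarrow> \<rho> x y \<le> B"
          using intrinsic_bounded_along_path[OF assms(1,2), of x y] assms(3) xy
          unfolding connected_graph_def by blast
        then show ?thesis using intr by (intro bdd_aboveI2[where M = B]) auto
      qed
      define S where "S = restr (\<lambda>x y. SUP \<rho>\<in>C. \<rho> x y)"
      have "intrinsic_pseudo_metric X m b (\<lambda>x y. SUP \<rho>\<in>C. \<rho> x y)"
      proof (rule intrinsic_directed_Sup[OF assms(1,2) False intr _ bdd])
        fix \<rho> \<tau> assume "\<rho> \<in> C" "\<tau> \<in> C"
        then show "\<exists>\<kappa>\<in>C. \<forall>x\<in>X. \<forall>y\<in>X. \<rho> x y \<le> \<kappa> x y \<and> \<tau> x y \<le> \<kappa> x y"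
          using chain[of \<rho> \<tau>] by (auto simp: le_fun_def)
      qed
      then have "intrinsic_pseudo_metric X m b S"
        unfolding S_def by (rule restr_intrinsic)
      moreover have "restr S = S"
        by (simp add: S_def restr_idem)
      moreover have upper: "\<rho> \<le> S" if \<rho>: "\<rho> \<in> C" for \<rho>
      proof -
        have "restr \<rho> \<le> S"
          using \<rho> bdd by (auto simp: S_def restr_def le_fun_def intro!: cSUP_upper)
        then show ?thesis using \<rho> C_sub by (auto simp: A_def)
      qed
      moreover have "restr \<sigma> \<le> S"
      proof -
        obtain \<rho> where \<rho>: "\<rho> \<in> C" using False by blast
        then have "restr \<sigma> \<le> \<rho>" using C_sub by (auto simp: A_def)
        also have "\<rho> \<le> S" using \<rho> by (rule upper)
        finally show ?thesis .
      qed
      ultimately show ?thesis by (auto simp: A_def)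
    qed
  qed
  then obtain \<rho> where \<rho>: "\<rho> \<in> A" and max: "\<And>\<tau>. \<tau> \<in> A \<Longrightarrow> \<rho> \<le> \<tau> \<Longrightarrow> \<tau> = \<rho>" by blast
  have above: "\<forall>x\<in>X. \<forall>y\<in>X. \<sigma> x y \<le> \<rho> x y"
  proof (intro ballI)
    fix x y assume "x \<in> X" "y \<in> X"
    moreover have "restr \<sigma> x y \<le> \<rho> x y" using \<rho> by (simp add: A_def le_fun_def)
    ultimately show "\<sigma> x y \<le> \<rho> x y" by (simp add: restr_def)
  qed
  have "\<tau> x y = \<rho> x y"
    if \<tau>: "intrinsic_pseudo_metric X m b \<tau>" "\<forall>x\<in>X. \<forall>y\<in>X. \<rho> x y \<le> \<tau> x y" and xy: "x \<in> X" "y \<in> X"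
    for \<tau> x y
  proof -
    have "restr \<rho> \<le> restr \<tau>"
      using \<tau>(2) by (auto simp: restr_def le_fun_def)
    then have le: "\<rho> \<le> restr \<tau>" using \<rho> by (simp add: A_def)
    moreover have "restr \<sigma> \<le> \<rho>" using \<rho> by (simp add: A_def)
    ultimately have "restr \<tau> \<in> A"
      using restr_intrinsic[OF \<tau>(1)] by (auto simp: A_def restr_idem intro: order_trans)
    then have "restr \<tau> = \<rho>" using le by (rule max)
    then have "\<rho> x y = restr \<tau> x y" by simp
    then show ?thesis using xy by (simp add: restr_def)
  qed
  then have "maximal_intrinsic_pseudo_metric X m b \<rho>"
    using \<rho> unfolding maximal_intrinsic_pseudo_metric_def A_def by blast
  with above show ?thesis by blast
qed

end
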